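(* Let $(Q,q)$ be a connected quandle with base point, and let $p\colon(\tilde Q,\tilde q)\to(Q,q)$ be its universal covering in the explicit form $$\tilde Q=\{(a,g)\in Q\times\mathrm{Adj}(Q)'\mid a=q^g\},\quad\tilde q=(q,1),\quad p(a,g)=a,$$ with operations $(a,g)*(b,h)=(a*b,\,g\,\mathrm{adj}(a)^{-1}\mathrm{adj}(b))$ and $(a,g)\,\bar{*}\,(b,h)=(a\,\bar{*}\,b,\,g\,\mathrm{adj}(a)\,\mathrm{adj}(b)^{-1})$. Then the left action $\pi_1(Q,q)\times\tilde Q\to\tilde Q$ defined by $h\cdot(a,g)=(a,hg)$ yields a canonical group isomorphism $\phi\colon\pi_1(Q,q)\to\mathrm{Aut}(p)$.
   Context: A quandle is a set $Q$ with two binary operations $*,\bar{*}$ such that for all $a,b,c\in Q$: $a*a=a$; $(a*b)\bar{*}b=a=(a\bar{*}b)*b$; $(a*b)*c=(a*c)*(b*c)$. $\mathrm{Inn}(Q)$ is the group of automorphisms of $Q$ generated by the right translations $x\mapsto x*a$ ($a\in Q$); $Q$ is connected if $\mathrm{Inn}(Q)$ acts transitively on $Q$. The adjoint group $\mathrm{Adj}(Q)$ is generated by symbols $\mathrm{adj}(a)$, $a\in Q$, subject to $\mathrm{adj}(a*b)=\mathrm{adj}(b)^{-1}\mathrm{adj}(a)\,\mathrm{adj}(b)$. It acts on $Q$ from the right by quandle automorphisms with $a^{\mathrm{adj}(b)}=a*b$. $\mathrm{Adj}(Q)'$ is the commutator subgroup (for connected $Q$ it is the kernel of the homomorphism $\mathrm{Adj}(Q)\to\mathbb{Z}$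 sending every $\mathrm{adj}(a)$ to $1$). The fundamental group is $\pi_1(Q,q)=\{g\in\mathrm{Adj}(Q)'\mid q^g=q\}$. A covering is a surjective quandle homomorphism $p\colon\tilde Q\to Q$ such that $p(\tilde y)=p(\tilde z)$ implies $\tilde x*\tilde y=\tilde x*\tilde z$ for all $\tilde x$. $\mathrm{Aut}(p)$ is the group of quandle automorphisms $\phi$ of $\tilde Q$ with $p\circ\phi=p$, acting on $\tilde Q$ from the left. *)

theory Defs
  imports "HOL-Algebra.Group_Action" "HOL-Algebra.Generated_Groups"
begin

section \<open>Quandles\<close>

record 'a quandle_str = "'a partial_object" +
  qmult :: "['a, 'a] \<Rightarrow> 'a" (infixl \<open>\<star>\<index>\<close> 70)
  qdiv  :: "['a, 'a] \<Rightarrow> 'a" (infixl \<open>\<diamondop>\<index>\<close> 70)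

locale quandle =
  fixes Q :: "('a, 'b) quandle_str_scheme" (structure)
  assumes qmult_closed [simp, intro]: "\<lbrakk>a \<in> carrier Q; b \<in> carrier Q\<rbrakk> \<Longrightarrow> a \<star> b \<in> carrier Q"
    and qdiv_closed [simp, intro]: "\<lbrakk>a \<in> carrier Q; b \<in> carrier Q\<rbrakk> \<Longrightarrow> a \<diamondop> b \<in> carrier Q"
    and idem [simp]: "a \<in> carrier Q \<Longrightarrow> a \<star> a = a"
    and qmult_qdiv [simp]: "\<lbrakk>a \<in> carrier Q; b \<in> carrier Q\<rbrakk> \<Longrightarrow> (a \<star> b) \<diamondop> b = a"
    and qdiv_qmult [simp]: "\<lbrakk>a \<in> carrier Q; b \<in> carrier Q\<rbrakk> \<Longrightarrow> (a \<diamondop> b) \<star> b = a"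
    and self_distrib: "\<lbrakk>a \<in> carrier Q; b \<in> carrier Q; c \<in> carrier Q\<rbrakk>
                       \<Longrightarrow> (a \<star> b) \<star> c = (a \<star> c) \<star> (b \<star> c)"

definition quandle_hom ::
    "('a, 'c) quandle_str_scheme \<Rightarrow> ('b, 'd) quandle_str_scheme \<Rightarrow> ('a \<Rightarrow> 'b) set"
  where "quandle_hom P Q =
    {f. f \<in> carrier P \<rightarrow> carrier Q \<and>
        (\<forall>x\<in>carrier P. \<forall>y\<in>carrier P. f (x \<star>\<^bsub>P\<^esub> y) = f x \<star>\<^bsub>Q\<^esub> f y)}"

text \<open>Automorphisms are extensional functions and act from the left:
  the product of \<open>f\<close> and \<open>g\<close> is \<open>x \<mapsto> f (g x)\<close>.\<close>

definition quandle_Aut :: "('a, 'b) quandle_str_scheme \<Rightarrow> ('a \<Rightarrow> 'a) monoid"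
  where "quandle_Aut Q =
    BijGroup (carrier Q) \<lparr>carrier := Bij (carrier Q) \<inter> quandle_hom Q Q\<rparr>"

definition right_translation :: "('a, 'b) quandle_str_scheme \<Rightarrow> 'a \<Rightarrow> 'a \<Rightarrow> 'a"
  where "right_translation Q a = (\<lambda>x\<in>carrier Q. x \<star>\<^bsub>Q\<^esub> a)"

definition quandle_Inn :: "('a, 'b) quandle_str_scheme \<Rightarrow> ('a \<Rightarrow> 'a) set"
  where "quandle_Inn Q = generate (quandle_Aut Q) (right_translation Q ` carrier Q)"

locale connected_quandle = quandle +
  assumes transitive: "\<lbrakk>x \<in> carrier Q; y \<in> carrier Q\<rbrakk> \<Longrightarrow> \<exists>f\<in>quandle_Inn Q. f x = y"

locale quandle_covering = P?: quandle P + Q?: quandle Q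
  for P :: "('a, 'c) quandle_str_scheme" and Q :: "('b, 'd) quandle_str_scheme" +
  fixes p :: "'a \<Rightarrow> 'b"
  assumes hom: "p \<in> quandle_hom P Q"
    and surj: "p ` carrier P = carrier Q"
    and fibres: "\<lbrakk>x \<in> carrier P; y \<in> carrier P; z \<in> carrier P; p y = p z\<rbrakk>
                 \<Longrightarrow> x \<star>\<^bsub>P\<^esub> y = x \<star>\<^bsub>P\<^esub> z"

definition covering_Aut :: "('a, 'c) quandle_str_scheme \<Rightarrow> ('a \<Rightarrow> 'b) \<Rightarrow> ('a \<Rightarrow> 'a) monoid"
  where "covering_Aut P p = (quandle_Aut P)
    \<lparr>carrier := {f \<in> carrier (quandle_Aut P). \<forall>x\<in>carrier P. p (f x) = p x}\<rparr>"


section \<open>Groups given by generators and relations\<close>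

datatype 'a letter = Gen 'a | Inv 'a

type_synonym 'a word = "'a letter list"

definition words :: "'a set \<Rightarrow> 'a word set"
  where "words S = lists (Gen ` S \<union> Inv ` S)"

text \<open>The least congruence on words over \<open>S\<close> that makes \<open>Inv a\<close> inverse to \<open>Gen a\<close>
  and identifies the two sides of every relation \<open>(u, v) \<in> R\<close>.\<close>

inductive pres_eq :: "'a set \<Rightarrow> ('a word \<times> 'a word) set \<Rightarrow> 'a word \<Rightarrow> 'a word \<Rightarrow> bool"
  for S :: "'a set" and R :: "('a word \<times> 'a word) set"
  where
    refl: "w \<in> words S \<Longrightarrow> pres_eq S R w w"
  | sym: "pres_eq S R u v \<Longrightarrow> pres_eq S R v u"
  | trans: "pres_eq S R u v \<Longrightarrow> pres_eq S R v w \<Longrightarrow> pres_eq S R u w"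
  | cong: "pres_eq S R u u' \<Longrightarrow> pres_eq S R v v' \<Longrightarrow> pres_eq S R (u @ v) (u' @ v')"
  | Gen_Inv: "a \<in> S \<Longrightarrow> pres_eq S R [Gen a, Inv a] []"
  | Inv_Gen: "a \<in> S \<Longrightarrow> pres_eq S R [Inv a, Gen a] []"
  | rel: "(u, v) \<in> R \<Longrightarrow> u \<in> words S \<Longrightarrow> v \<in> words S \<Longrightarrow> pres_eq S R u v"

definition word_class :: "'a set \<Rightarrow> ('a word \<times> 'a word) set \<Rightarrow> 'a word \<Rightarrow> 'a word set"
  where "word_class S R w = {v. pres_eq S R w v}"

definition presented_group :: "'a set \<Rightarrow> ('a word \<times> 'a word) set \<Rightarrow> 'a word set monoid"
  where "presented_group S R =
    \<lparr>carrier = word_class S R ` words S,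
     mult = \<lambda>A B. \<Union>u\<in>A. \<Union>v\<in>B. word_class S R (u @ v),
     one = word_class S R []\<rparr>"

lemma words_simps [simp]:
  "[] \<in> words S"
  "u @ v \<in> words S \<longleftrightarrow> u \<in> words S \<and> v \<in> words S"
  "Gen a # w \<in> words S \<longleftrightarrow> a \<in> S \<and> w \<in> words S"
  "Inv a # w \<in> words S \<longleftrightarrow> a \<in> S \<and> w \<in> words S"
  by (auto simp: words_def)

lemma pres_eq_words: "pres_eq S R u v \<Longrightarrow> u \<in> words S \<and> v \<in> words S"
  by (induction rule: pres_eq.induct) auto

lemma word_class_eq_iff:
  assumes "u \<in> words S" "v \<in> words S"
  shows "word_class S R u = word_class S R v \<longleftrightarrow> pres_eq S R u v"
proof
  assume "word_class S R u = word_class S R v"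
  then show "pres_eq S R u v"
    using pres_eq.refl[OF assms(2)] by (auto simp: word_class_def)
next
  assume uv: "pres_eq S R u v"
  show "word_class S R u = word_class S R v"
    using pres_eq.trans[OF uv] pres_eq.trans[OF pres_eq.sym[OF uv]] by (auto simp: word_class_def)
qed

lemma word_class_mult:
  assumes "u \<in> words S" "v \<in> words S"
  shows "word_class S R u \<otimes>\<^bsub>presented_group S R\<^esub> word_class S R v = word_class S R (u @ v)"
proof -
  have eq: "word_class S R (u' @ v') = word_class S R (u @ v)"
    if "u' \<in> word_class S R u" "v' \<in> word_class S R v" for u' v'
  proof -
    have uv: "pres_eq S R u u'" "pres_eq S R v v'"
      using that by (simp_all add: word_class_def)
    then show ?thesis
      using assms pres_eq_words[OF uv(1)] pres_eq_words[OF uv(2)] pres_eq.sym[OF pres_eq.cong[OF uv]]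
      by (simp add: word_class_eq_iff)
  qed
  have ne: "word_class S R u \<noteq> {}" "word_class S R v \<noteq> {}"
    using pres_eq.refl[OF assms(1)] pres_eq.refl[OF assms(2)] by (auto simp only: word_class_def)
  have "word_class S R u \<otimes>\<^bsub>presented_group S R\<^esub> word_class S R v =
      (\<Union>u'\<in>word_class S R u. \<Union>v'\<in>word_class S R v. word_class S R (u' @ v'))"
    by (simp add: presented_group_def)
  also have "\<dots> = (\<Union>u'\<in>word_class S R u. \<Union>v'\<in>word_class S R v. word_class S R (u @ v))"
    by (intro SUP_cong HOL.refl eq)
  also have "\<dots> = word_class S R (u @ v)"
    using ne by (simp only: UN_constant if_False)
  finally show ?thesis .
qed

fun letter_inv :: "'a letter \<Rightarrow> 'a letter" where
  "letter_inv (Gen a) = Inv a"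
| "letter_inv (Inv a) = Gen a"

lemma word_left_inverse:
  "w \<in> words S \<Longrightarrow> \<exists>v\<in>words S. pres_eq S R (v @ w) []"
proof (induction w)
  case Nil
  then show ?case by (auto intro!: bexI[of _ "[]"] pres_eq.refl)
next
  case (Cons l w)
  then obtain v where v: "v \<in> words S" "pres_eq S R (v @ w) []" "w \<in> words S"
    by (cases l) auto
  have l: "pres_eq S R [letter_inv l, l] []"
    using Cons.prems by (cases l) (auto intro: pres_eq.Gen_Inv pres_eq.Inv_Gen)
  have "pres_eq S R (v @ ([letter_inv l, l] @ w)) (v @ ([] @ w))"
    by (intro pres_eq.cong pres_eq.refl v l)
  then have "pres_eq S R ((v @ [letter_inv l]) @ l # w) []"
    using pres_eq.trans[OF _ v(2)] by simp
  moreover have "v @ [letter_inv l] \<in> words S"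
    using Cons.prems v by (cases l) auto
  ultimately show ?case by blast
qed

lemma group_presented_group: "group (presented_group S R)"
proof (rule groupI)
  have carr: "carrier (presented_group S R) = word_class S R ` words S"
    and one: "\<one>\<^bsub>presented_group S R\<^esub> = word_class S R []"
    by (auto simp: presented_group_def)
  show "\<one>\<^bsub>presented_group S R\<^esub> \<in> carrier (presented_group S R)"
    by (auto simp: carr one)
  show "x \<otimes>\<^bsub>presented_group S R\<^esub> y \<in> carrier (presented_group S R)"
    if "x \<in> carrier (presented_group S R)" "y \<in> carrier (presented_group S R)" for x y
    using that by (auto simp: carr word_class_mult)
  show "\<one>\<^bsub>presented_group S R\<^esub> \<otimes>\<^bsub>presented_group S R\<^esub> x = x"
    if "x \<in> carrier (presented_group S R)" for x
    using that by (auto simp: carr one word_class_mult)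
  show "(x \<otimes>\<^bsub>presented_group S R\<^esub> y) \<otimes>\<^bsub>presented_group S R\<^esub> z =
      x \<otimes>\<^bsub>presented_group S R\<^esub> (y \<otimes>\<^bsub>presented_group S R\<^esub> z)"
    if "x \<in> carrier (presented_group S R)" "y \<in> carrier (presented_group S R)"
      "z \<in> carrier (presented_group S R)" for x y z
    using that by (auto simp: carr word_class_mult)
  show "\<exists>y\<in>carrier (presented_group S R). y \<otimes>\<^bsub>presented_group S R\<^esub> x = \<one>\<^bsub>presented_group S R\<^esub>"
    if "x \<in> carrier (presented_group S R)" for x
  proof -
    from that obtain w where w: "w \<in> words S" "x = word_class S R w" by (auto simp: carr)
    from word_left_inverse[OF w(1)] obtain v where v: "v \<in> words S" "pres_eq S R (v @ w) []"
      by blast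
    then show ?thesis
      using w by (auto simp: carr one word_class_mult word_class_eq_iff intro!: bexI[of _ "word_class S R v"])
  qed
qed


section \<open>Adjoint group and fundamental group\<close>

definition adj_relations :: "('a, 'b) quandle_str_scheme \<Rightarrow> ('a word \<times> 'a word) set"
  where "adj_relations Q =
    {([Gen (a \<star>\<^bsub>Q\<^esub> b)], [Inv b, Gen a, Gen b]) | a b. a \<in> carrier Q \<and> b \<in> carrier Q}"

definition Adj :: "('a, 'b) quandle_str_scheme \<Rightarrow> 'a word set monoid"
  where "Adj Q = presented_group (carrier Q) (adj_relations Q)"

definition adj :: "('a, 'b) quandle_str_scheme \<Rightarrow> 'a \<Rightarrow> 'a word set"
  where "adj Q a = word_class (carrier Q) (adj_relations Q) [Gen a]"

definition Adj_derived :: "('a, 'b) quandle_str_scheme \<Rightarrow> 'a word set set"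
  where "Adj_derived Q = derived (Adj Q) (carrier (Adj Q))"

text \<open>The right action of words: letters act from left to right.\<close>

fun letter_act :: "('a, 'b) quandle_str_scheme \<Rightarrow> 'a letter \<Rightarrow> 'a \<Rightarrow> 'a" where
  "letter_act Q (Gen b) x = x \<star>\<^bsub>Q\<^esub> b"
| "letter_act Q (Inv b) x = x \<diamondop>\<^bsub>Q\<^esub> b"

definition word_act :: "('a, 'b) quandle_str_scheme \<Rightarrow> 'a word \<Rightarrow> 'a \<Rightarrow> 'a"
  where "word_act Q w x = fold (letter_act Q) w x"

text \<open>An element of the adjoint group is a class of words; that they all act alike is
  \<open>adj_act_word_class\<close> below.\<close>

definition adj_act :: "('a, 'b) quandle_str_scheme \<Rightarrow> 'a \<Rightarrow> 'a word set \<Rightarrow> 'a"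
  where "adj_act Q x g = (THE y. \<exists>w\<in>g. y = word_act Q w x)"

definition fundamental_group :: "('a, 'b) quandle_str_scheme \<Rightarrow> 'a \<Rightarrow> 'a word set monoid"
  where "fundamental_group Q q = (Adj Q) \<lparr>carrier := {g \<in> Adj_derived Q. adj_act Q q g = q}\<rparr>"

lemma group_Adj: "group (Adj Q)"
  unfolding Adj_def by (rule group_presented_group)

context quandle
begin

lemma qdiv_qmult_distrib:
  assumes "a \<in> carrier Q" "b \<in> carrier Q" "c \<in> carrier Q"
  shows "(a \<diamondop> b) \<star> c = (a \<star> c) \<diamondop> (b \<star> c)"
proof -
  have "((a \<diamondop> b) \<star> c) \<star> (b \<star> c) = a \<star> c"
    using assms self_distrib[of "a \<diamondop> b" b c] by simp
  then show ?thesis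
    using assms qmult_qdiv[of "(a \<diamondop> b) \<star> c" "b \<star> c"] by simp
qed

lemma letter_act_closed:
  "l \<in> Gen ` carrier Q \<union> Inv ` carrier Q \<Longrightarrow> x \<in> carrier Q \<Longrightarrow> letter_act Q l x \<in> carrier Q"
  by auto

lemma word_act_closed:
  "w \<in> words (carrier Q) \<Longrightarrow> x \<in> carrier Q \<Longrightarrow> word_act Q w x \<in> carrier Q"
proof (induction w arbitrary: x)
  case (Cons l w)
  then show ?case by (cases l) (auto simp: word_act_def)
qed (simp add: word_act_def)

lemma word_act_append: "word_act Q (u @ v) x = word_act Q v (word_act Q u x)"
  by (simp add: word_act_def)

lemma word_act_pres_eq:
  assumes "pres_eq (carrier Q) (adj_relations Q) u v" "x \<in> carrier Q"
  shows "word_act Q u x = word_act Q v x"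
  using assms
proof (induction arbitrary: x rule: pres_eq.induct)
  case (cong u u' v v')
  then show ?case
    using pres_eq_words[OF cong.hyps(1)] by (simp add: word_act_append word_act_closed)
next
  case (rel u v)
  then obtain a b where ab: "a \<in> carrier Q" "b \<in> carrier Q"
    "u = [Gen (a \<star> b)]" "v = [Inv b, Gen a, Gen b]"
    by (auto simp: adj_relations_def)
  then show ?case
    using rel.prems self_distrib[of "x \<diamondop> b" a b] by (simp add: word_act_def)
qed (auto simp: word_act_def)

lemma adj_act_word_class:
  assumes "w \<in> words (carrier Q)" "x \<in> carrier Q"
  shows "adj_act Q x (word_class (carrier Q) (adj_relations Q) w) = word_act Q w x"
  unfolding adj_act_def
proof (rule the_equality)
  show "\<exists>v\<in>word_class (carrier Q) (adj_relations Q) w. word_act Q w x = word_act Q v x"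
    using assms by (auto simp: word_class_def intro!: exI[of _ w] pres_eq.refl)
qed (use assms word_act_pres_eq in \<open>auto simp: word_class_def\<close>)

lemma carrier_Adj: "carrier (Adj Q) = word_class (carrier Q) (adj_relations Q) ` words (carrier Q)"
  by (simp add: Adj_def presented_group_def)

lemma adj_closed [simp, intro]: "a \<in> carrier Q \<Longrightarrow> adj Q a \<in> carrier (Adj Q)"
  by (auto simp: carrier_Adj adj_def)

lemma inv_adj:
  assumes "a \<in> carrier Q"
  shows "inv\<^bsub>Adj Q\<^esub> adj Q a = word_class (carrier Q) (adj_relations Q) [Inv a]"
proof -
  interpret A: group "Adj Q" by (rule group_Adj)
  let ?c = "word_class (carrier Q) (adj_relations Q)"
  have "?c [Inv a] \<otimes>\<^bsub>Adj Q\<^esub> adj Q a = ?c [Inv a, Gen a]"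
    using assms by (simp add: Adj_def adj_def word_class_mult)
  also have "\<dots> = ?c []"
    using assms by (subst word_class_eq_iff) (auto intro: pres_eq.Inv_Gen)
  also have "\<dots> = \<one>\<^bsub>Adj Q\<^esub>"
    by (simp add: Adj_def presented_group_def)
  finally show ?thesis
    using assms by (intro A.inv_equality) (simp_all add: carrier_Adj adj_def)
qed

lemma adj_act_adj:
  assumes "x \<in> carrier Q" "a \<in> carrier Q"
  shows "adj_act Q x (adj Q a) = x \<star> a" "adj_act Q x (inv\<^bsub>Adj Q\<^esub> adj Q a) = x \<diamondop> a"
  using assms by (simp_all add: inv_adj, simp_all add: adj_def adj_act_word_class word_act_def)

lemma adj_act_closed:
  "x \<in> carrier Q \<Longrightarrow> g \<in> carrier (Adj Q) \<Longrightarrow> adj_act Q x g \<in> carrier Q"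
  by (auto simp: carrier_Adj adj_act_word_class word_act_closed)

lemma adj_act_one: "x \<in> carrier Q \<Longrightarrow> adj_act Q x \<one>\<^bsub>Adj Q\<^esub> = x"
  using adj_act_word_class[of "[]" x] by (simp add: Adj_def presented_group_def word_act_def)

lemma adj_act_mult:
  assumes "x \<in> carrier Q" "g \<in> carrier (Adj Q)" "h \<in> carrier (Adj Q)"
  shows "adj_act Q x (g \<otimes>\<^bsub>Adj Q\<^esub> h) = adj_act Q (adj_act Q x g) h"
proof -
  obtain u v where uv: "u \<in> words (carrier Q)" "v \<in> words (carrier Q)"
    "g = word_class (carrier Q) (adj_relations Q) u" "h = word_class (carrier Q) (adj_relations Q) v"
    using assms by (auto simp: carrier_Adj)
  have "g \<otimes>\<^bsub>Adj Q\<^esub> h = word_class (carrier Q) (adj_relations Q) (u @ v)"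
    using uv by (simp add: Adj_def word_class_mult)
  then show ?thesis
    using assms uv by (simp add: adj_act_word_class word_act_append word_act_closed)
qed

end


section \<open>The universal covering of a pointed connected quandle\<close>

definition univ_cover ::
    "('a, 'b) quandle_str_scheme \<Rightarrow> 'a \<Rightarrow> ('a \<times> 'a word set) quandle_str"
  where "univ_cover Q q =
    \<lparr>carrier = {(a, g). a \<in> carrier Q \<and> g \<in> Adj_derived Q \<and> a = adj_act Q q g},
     qmult = \<lambda>(a, g) (b, h).
       (a \<star>\<^bsub>Q\<^esub> b, g \<otimes>\<^bsub>Adj Q\<^esub> inv\<^bsub>Adj Q\<^esub> (adj Q a) \<otimes>\<^bsub>Adj Q\<^esub> adj Q b),
     qdiv = \<lambda>(a, g) (b, h).
       (a \<diamondop>\<^bsub>Q\<^esub> b, g \<otimes>\<^bsub>Adj Q\<^esub> adj Q a \<otimes>\<^bsub>Adj Q\<^esub> inv\<^bsub>Adj Q\<^esub> (adj Q b))\<rparr>"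

definition univ_cover_proj :: "'a \<times> 'a word set \<Rightarrow> 'a"
  where "univ_cover_proj = (\<lambda>(a, g). a)"

definition deck_action ::
    "('a, 'b) quandle_str_scheme \<Rightarrow> 'a \<Rightarrow> 'a word set \<Rightarrow> 'a \<times> 'a word set \<Rightarrow> 'a \<times> 'a word set"
  where "deck_action Q q h = (\<lambda>(a, g)\<in>carrier (univ_cover Q q). (a, h \<otimes>\<^bsub>Adj Q\<^esub> g))"

text \<open>The remaining lemmas lead to \<open>univ_cover_quandle_covering\<close>: for connected \<open>Q\<close>,
  \<open>univ_cover Q q\<close> is a quandle and the projection is a covering.\<close>

context quandle
begin

lemma subgroup_quandle_Aut: "subgroup (Bij (carrier Q) \<inter> quandle_hom Q Q) (BijGroup (carrier Q))"
proof -
  interpret B: group "BijGroup (carrier Q)" by (rule group_BijGroup)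
  show ?thesis
  proof (rule B.subgroupI)
    show "Bij (carrier Q) \<inter> quandle_hom Q Q \<subseteq> carrier (BijGroup (carrier Q))"
      by (auto simp: BijGroup_def)
    have "(\<lambda>x\<in>carrier Q. x) \<in> Bij (carrier Q) \<inter> quandle_hom Q Q"
      by (auto simp: id_Bij quandle_hom_def)
    then show "Bij (carrier Q) \<inter> quandle_hom Q Q \<noteq> {}" by blast
  next
    fix f assume f: "f \<in> Bij (carrier Q) \<inter> quandle_hom Q Q"
    let ?g = "\<lambda>x\<in>carrier Q. inv_into (carrier Q) f x"
    have "?g (x \<star> y) = ?g x \<star> ?g y" if "x \<in> carrier Q" "y \<in> carrier Q" for x y
    proof -
      have fi: "f (inv_into (carrier Q) f z) = z" if "z \<in> carrier Q" for z
        using f that by (auto simp: Bij_def bij_betw_def intro!: f_inv_into_f)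
      have mem: "inv_into (carrier Q) f z \<in> carrier Q" if "z \<in> carrier Q" for z
        using f that by (auto intro: Bij_inv_into_mem)
      have "f (inv_into (carrier Q) f x \<star> inv_into (carrier Q) f y) = x \<star> y"
        using f that fi mem by (auto simp: quandle_hom_def)
      then have "inv_into (carrier Q) f (x \<star> y) = inv_into (carrier Q) f x \<star> inv_into (carrier Q) f y"
        using f that mem by (intro inv_into_f_eq) (auto simp: Bij_def bij_betw_def)
      then show ?thesis using that by simp
    qed
    then have "?g \<in> Bij (carrier Q) \<inter> quandle_hom Q Q"
      using f restrict_inv_into_Bij[of f "carrier Q"]
      by (auto simp: quandle_hom_def intro: Bij_inv_into_mem)
    then show "inv\<^bsub>BijGroup (carrier Q)\<^esub> f \<in> Bij (carrier Q) \<inter> quandle_hom Q Q"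
      using f by (simp add: inv_BijGroup)
  next
    fix f g
    assume "f \<in> Bij (carrier Q) \<inter> quandle_hom Q Q" "g \<in> Bij (carrier Q) \<inter> quandle_hom Q Q"
    then show "f \<otimes>\<^bsub>BijGroup (carrier Q)\<^esub> g \<in> Bij (carrier Q) \<inter> quandle_hom Q Q"
      by (auto simp: BijGroup_def compose_Bij quandle_hom_def compose_eq Pi_iff) 
  qed
qed

lemma group_quandle_Aut: "group (quandle_Aut Q)"
  unfolding quandle_Aut_def
  by (rule subgroup.subgroup_is_group[OF subgroup_quandle_Aut group_BijGroup])

lemma right_translation_Aut:
  assumes "a \<in> carrier Q"
  shows "right_translation Q a \<in> carrier (quandle_Aut Q)"
    and "inv\<^bsub>quandle_Aut Q\<^esub> right_translation Q a = (\<lambda>x\<in>carrier Q. x \<diamondop> a)"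
proof -
  interpret A: group "quandle_Aut Q" by (rule group_quandle_Aut)
  have bij: "bij_betw (\<lambda>x\<in>carrier Q. x \<star> a) (carrier Q) (carrier Q)"
    "bij_betw (\<lambda>x\<in>carrier Q. x \<diamondop> a) (carrier Q) (carrier Q)"
    by (rule bij_betw_byWitness[where f' = "\<lambda>x. x \<diamondop> a"]; use assms in auto)
       (rule bij_betw_byWitness[where f' = "\<lambda>x. x \<star> a"]; use assms in auto)
  have hom: "(\<lambda>x\<in>carrier Q. x \<diamondop> a) \<in> quandle_hom Q Q"
  proof -
    have "(x \<star> y) \<diamondop> a = (x \<diamondop> a) \<star> (y \<diamondop> a)" if "x \<in> carrier Q" "y \<in> carrier Q" for x y
      using assms that self_distrib[of "x \<diamondop> a" "y \<diamondop> a" a]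
        qmult_qdiv[of "(x \<diamondop> a) \<star> (y \<diamondop> a)" a] by simp
    then show ?thesis using assms by (simp add: quandle_hom_def)
  qed
  have "(\<lambda>x\<in>carrier Q. x \<star> a) \<in> quandle_hom Q Q"
    using assms self_distrib[OF _ _ assms] by (simp add: quandle_hom_def)
  then show r: "right_translation Q a \<in> carrier (quandle_Aut Q)"
    using bij by (simp add: right_translation_def quandle_Aut_def Bij_def)
  have d: "(\<lambda>x\<in>carrier Q. x \<diamondop> a) \<in> carrier (quandle_Aut Q)"
    using hom bij by (auto simp: quandle_Aut_def Bij_def)
  have "(\<lambda>x\<in>carrier Q. x \<diamondop> a) \<otimes>\<^bsub>quandle_Aut Q\<^esub> right_translation Q a = \<one>\<^bsub>quandle_Aut Q\<^esub>"
    using assms r d by (auto simp: quandle_Aut_def BijGroup_def right_translation_def compose_def fun_eq_iff)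
  then show "inv\<^bsub>quandle_Aut Q\<^esub> right_translation Q a = (\<lambda>x\<in>carrier Q. x \<diamondop> a)"
    using r d A.inv_equality by blast
qed

lemma Inn_word_act:
  assumes "f \<in> quandle_Inn Q"
  shows "\<exists>w\<in>words (carrier Q). \<forall>x\<in>carrier Q. f x = word_act Q w x"
proof -
  interpret A: group "quandle_Aut Q" by (rule group_quandle_Aut)
  have in_Aut: "generate (quandle_Aut Q) (right_translation Q ` carrier Q) \<subseteq> carrier (quandle_Aut Q)"
    using right_translation_Aut(1) by (intro A.generate_incl) auto
  show ?thesis
    using assms unfolding quandle_Inn_def
  proof (induction rule: generate.induct)
    case one
    then show ?case
      by (intro bexI[of _ "[]"]) (auto simp: quandle_Aut_def BijGroup_def word_act_def)
  next
    case (incl h)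
    then obtain a where "a \<in> carrier Q" "h = right_translation Q a" by auto
    then show ?case
      by (intro bexI[of _ "[Gen a]"]) (auto simp: right_translation_def word_act_def)
  next
    case (inv h)
    then obtain a where "a \<in> carrier Q" "h = right_translation Q a" by auto
    then show ?case
      by (intro bexI[of _ "[Inv a]"]) (auto simp: right_translation_Aut word_act_def)
  next
    case (eng f g)
    then obtain u v where uv: "u \<in> words (carrier Q)" "\<forall>x\<in>carrier Q. f x = word_act Q u x"
      "v \<in> words (carrier Q)" "\<forall>x\<in>carrier Q. g x = word_act Q v x" by blast
    have "f \<in> carrier (quandle_Aut Q)" "g \<in> carrier (quandle_Aut Q)"
      using eng.hyps in_Aut by blast+
    then have "f \<otimes>\<^bsub>quandle_Aut Q\<^esub> g = compose (carrier Q) f g"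
      by (auto simp: quandle_Aut_def BijGroup_def)
    then show ?case
      using uv by (intro bexI[of _ "v @ u"]) (auto simp: compose_eq word_act_append word_act_closed)
  qed
qed

lemma adj_qmult:
  assumes "a \<in> carrier Q" "b \<in> carrier Q"
  shows "adj Q (a \<star> b) = inv\<^bsub>Adj Q\<^esub> adj Q b \<otimes>\<^bsub>Adj Q\<^esub> adj Q a \<otimes>\<^bsub>Adj Q\<^esub> adj Q b"
proof -
  have "inv\<^bsub>Adj Q\<^esub> adj Q b \<otimes>\<^bsub>Adj Q\<^esub> adj Q a \<otimes>\<^bsub>Adj Q\<^esub> adj Q b =
      word_class (carrier Q) (adj_relations Q) [Inv b, Gen a, Gen b]"
    unfolding inv_adj[OF assms(2)] using assms by (simp add: Adj_def adj_def word_class_mult)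
  also have "\<dots> = adj Q (a \<star> b)"
    unfolding adj_def using assms
    by (subst word_class_eq_iff) (auto intro!: pres_eq.sym[OF pres_eq.rel] simp: adj_relations_def)
  finally show ?thesis by simp
qed

lemma adj_qdiv:
  assumes "a \<in> carrier Q" "b \<in> carrier Q"
  shows "adj Q (a \<diamondop> b) = adj Q b \<otimes>\<^bsub>Adj Q\<^esub> adj Q a \<otimes>\<^bsub>Adj Q\<^esub> inv\<^bsub>Adj Q\<^esub> adj Q b"
proof -
  interpret A: group "Adj Q" by (rule group_Adj)
  have "adj Q a = inv\<^bsub>Adj Q\<^esub> adj Q b \<otimes>\<^bsub>Adj Q\<^esub> adj Q (a \<diamondop> b) \<otimes>\<^bsub>Adj Q\<^esub> adj Q b"
    using adj_qmult[of "a \<diamondop> b" b] assms by simp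
  then have "adj Q b \<otimes>\<^bsub>Adj Q\<^esub> adj Q a = adj Q (a \<diamondop> b) \<otimes>\<^bsub>Adj Q\<^esub> adj Q b"
    using assms by (simp add: A.m_assoc A.inv_solve_left)
  then show ?thesis
    using assms by (simp add: A.inv_solve_right)
qed

lemma adj_word_act:
  assumes "w \<in> words (carrier Q)" "x \<in> carrier Q"
  shows "\<exists>g\<in>carrier (Adj Q). adj Q (word_act Q w x) = inv\<^bsub>Adj Q\<^esub> g \<otimes>\<^bsub>Adj Q\<^esub> adj Q x \<otimes>\<^bsub>Adj Q\<^esub> g"
  using assms
proof (induction w arbitrary: x)
  case Nil
  interpret A: group "Adj Q" by (rule group_Adj)
  show ?case using Nil by (intro bexI[of _ "\<one>\<^bsub>Adj Q\<^esub>"]) (auto simp: word_act_def)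
next
  case (Cons l w)
  interpret A: group "Adj Q" by (rule group_Adj)
  have step: "word_act Q (l # w) x = word_act Q w (letter_act Q l x)"
    by (simp add: word_act_def)
  have mem: "letter_act Q l x \<in> carrier Q" "w \<in> words (carrier Q)"
    using Cons.prems by (cases l; auto)+
  then obtain g where g: "g \<in> carrier (Adj Q)" "adj Q (word_act Q (l # w) x) =
      inv\<^bsub>Adj Q\<^esub> g \<otimes>\<^bsub>Adj Q\<^esub> adj Q (letter_act Q l x) \<otimes>\<^bsub>Adj Q\<^esub> g"
    using Cons.IH step by metis
  obtain k where k: "k \<in> carrier (Adj Q)" "adj Q (letter_act Q l x) =
      inv\<^bsub>Adj Q\<^esub> k \<otimes>\<^bsub>Adj Q\<^esub> adj Q x \<otimes>\<^bsub>Adj Q\<^esub> k"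
  proof (cases l)
    case (Gen b)
    then show ?thesis using Cons.prems that[of "adj Q b"] by (simp add: adj_qmult)
  next
    case (Inv b)
    then show ?thesis using Cons.prems that[of "inv\<^bsub>Adj Q\<^esub> adj Q b"] by (simp add: adj_qdiv)
  qed
  show ?case
    using g k Cons.prems
    by (intro bexI[of _ "k \<otimes>\<^bsub>Adj Q\<^esub> g"]) (auto simp: A.inv_mult_group A.m_assoc)
qed

end

context connected_quandle
begin

lemma inv_adj_adj_derived:
  assumes "a \<in> carrier Q" "b \<in> carrier Q"
  shows "inv\<^bsub>Adj Q\<^esub> adj Q a \<otimes>\<^bsub>Adj Q\<^esub> adj Q b \<in> Adj_derived Q"
    and "adj Q a \<otimes>\<^bsub>Adj Q\<^esub> inv\<^bsub>Adj Q\<^esub> adj Q b \<in> Adj_derived Q"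
proof -
  interpret A: group "Adj Q" by (rule group_Adj)
  obtain f where "f \<in> quandle_Inn Q" "f a = b" using transitive assms by blast
  then obtain w where "w \<in> words (carrier Q)" "b = word_act Q w a"
    using Inn_word_act assms by blast
  then obtain g where g: "g \<in> carrier (Adj Q)"
    "adj Q b = inv\<^bsub>Adj Q\<^esub> g \<otimes>\<^bsub>Adj Q\<^esub> adj Q a \<otimes>\<^bsub>Adj Q\<^esub> g"
    using adj_word_act assms by blast
  have comm: "x \<otimes>\<^bsub>Adj Q\<^esub> y \<otimes>\<^bsub>Adj Q\<^esub> inv\<^bsub>Adj Q\<^esub> x \<otimes>\<^bsub>Adj Q\<^esub> inv\<^bsub>Adj Q\<^esub> y \<in> Adj_derived Q"
    if "x \<in> carrier (Adj Q)" "y \<in> carrier (Adj Q)" for x y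
    unfolding Adj_derived_def derived_def using that by (intro generate.incl) blast
  show "inv\<^bsub>Adj Q\<^esub> adj Q a \<otimes>\<^bsub>Adj Q\<^esub> adj Q b \<in> Adj_derived Q"
    using comm[of "inv\<^bsub>Adj Q\<^esub> adj Q a" "inv\<^bsub>Adj Q\<^esub> g"] g assms by (simp add: A.m_assoc)
  show "adj Q a \<otimes>\<^bsub>Adj Q\<^esub> inv\<^bsub>Adj Q\<^esub> adj Q b \<in> Adj_derived Q"
    using comm[of "adj Q a" "inv\<^bsub>Adj Q\<^esub> g"] g assms by (simp add: A.m_assoc A.inv_mult_group)
qed

lemma subgroup_Adj_derived: "subgroup (Adj_derived Q) (Adj Q)"
  unfolding Adj_derived_def using group.derived_is_subgroup[OF group_Adj] by blast

lemma Adj_derived_carrier: "g \<in> Adj_derived Q \<Longrightarrow> g \<in> carrier (Adj Q)"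
  using subgroup.subset[OF subgroup_Adj_derived] by blast

lemma adj_act_transitive:
  assumes "q \<in> carrier Q" "a \<in> carrier Q"
  shows "\<exists>g\<in>Adj_derived Q. adj_act Q q g = a"
proof -
  interpret A: group "Adj Q" by (rule group_Adj)
  have "\<exists>g\<in>Adj_derived Q. adj_act Q x g = word_act Q w x"
    if "w \<in> words (carrier Q)" "x \<in> carrier Q" for w x
    using that
  proof (induction w arbitrary: x)
    case Nil
    then show ?case
      using subgroup.one_closed[OF subgroup_Adj_derived]
      by (intro bexI[of _ "\<one>\<^bsub>Adj Q\<^esub>"]) (auto simp: word_act_def adj_act_one)
  next
    case (Cons l w)
    have mem: "letter_act Q l x \<in> carrier Q" "w \<in> words (carrier Q)"
      using Cons.prems by (cases l; auto)+
    then obtain g where g: "g \<in> Adj_derived Q"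
      "adj_act Q (letter_act Q l x) g = word_act Q w (letter_act Q l x)"
      using Cons.IH by blast
    have "x \<diamondop> x = x"
      using Cons.prems qmult_qdiv[of x x] by simp
    then obtain k where k: "k \<in> Adj_derived Q" "adj_act Q x k = letter_act Q l x"
    proof (cases l)
      case (Gen b)
      then show ?thesis
        using Cons.prems inv_adj_adj_derived(1)[of x b] \<open>x \<diamondop> x = x\<close>
        by (intro that[of "inv\<^bsub>Adj Q\<^esub> adj Q x \<otimes>\<^bsub>Adj Q\<^esub> adj Q b"])
           (auto simp: adj_act_mult adj_act_adj)
    next
      case (Inv b)
      then show ?thesis
        using Cons.prems inv_adj_adj_derived(2)[of x b]
        by (intro that[of "adj Q x \<otimes>\<^bsub>Adj Q\<^esub> inv\<^bsub>Adj Q\<^esub> adj Q b"])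
           (auto simp: adj_act_mult adj_act_adj)
    qed
    show ?case
      using g k Cons.prems subgroup.m_closed[OF subgroup_Adj_derived k(1) g(1)]
      by (intro bexI[of _ "k \<otimes>\<^bsub>Adj Q\<^esub> g"])
         (auto simp: adj_act_mult Adj_derived_carrier word_act_def)
  qed
  moreover obtain f where "f \<in> quandle_Inn Q" "f q = a" using transitive assms by blast
  ultimately show ?thesis using Inn_word_act assms by metis
qed

lemma univ_cover_quandle_covering:
  assumes q: "q \<in> carrier Q"
  shows "quandle_covering (univ_cover Q q) Q univ_cover_proj"
proof -
  interpret A: group "Adj Q" by (rule group_Adj)
  let ?P = "univ_cover Q q"
  have carr: "x \<in> carrier ?P \<longleftrightarrow>
      fst x \<in> carrier Q \<and> snd x \<in> Adj_derived Q \<and> fst x = adj_act Q q (snd x)" for x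
    by (auto simp: univ_cover_def)
  have qm: "x \<star>\<^bsub>?P\<^esub> y = (fst x \<star> fst y,
      snd x \<otimes>\<^bsub>Adj Q\<^esub> (inv\<^bsub>Adj Q\<^esub> adj Q (fst x) \<otimes>\<^bsub>Adj Q\<^esub> adj Q (fst y)))"
    if "x \<in> carrier ?P" "y \<in> carrier ?P" for x y
    using that by (auto simp: univ_cover_def A.m_assoc Adj_derived_carrier)
  have qd: "x \<diamondop>\<^bsub>?P\<^esub> y = (fst x \<diamondop> fst y,
      snd x \<otimes>\<^bsub>Adj Q\<^esub> (adj Q (fst x) \<otimes>\<^bsub>Adj Q\<^esub> inv\<^bsub>Adj Q\<^esub> adj Q (fst y)))"
    if "x \<in> carrier ?P" "y \<in> carrier ?P" for x y
    using that by (auto simp: univ_cover_def A.m_assoc Adj_derived_carrier)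
  have dd: "a \<diamondop> a = a" if "a \<in> carrier Q" for a
    using that qmult_qdiv[of a a] by simp
  have act: "adj_act Q q (snd x) = fst x" "snd x \<in> carrier (Adj Q)" "fst x \<in> carrier Q"
    "snd x \<in> Adj_derived Q"
    if "x \<in> carrier ?P" for x
    using that by (auto simp: carr Adj_derived_carrier)
  have cm: "x \<star>\<^bsub>?P\<^esub> y \<in> carrier ?P" if "x \<in> carrier ?P" "y \<in> carrier ?P" for x y
    unfolding qm[OF that] carr fst_conv snd_conv
    using act[OF that(1)] act[OF that(2)] inv_adj_adj_derived q
    by (simp add: adj_act_mult adj_act_adj dd subgroup.m_closed[OF subgroup_Adj_derived])
  have cd: "x \<diamondop>\<^bsub>?P\<^esub> y \<in> carrier ?P" if "x \<in> carrier ?P" "y \<in> carrier ?P" for x y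
    unfolding qd[OF that] carr fst_conv snd_conv
    using act[OF that(1)] act[OF that(2)] inv_adj_adj_derived q
    by (simp add: adj_act_mult adj_act_adj dd subgroup.m_closed[OF subgroup_Adj_derived])
  have canc: "u \<otimes>\<^bsub>Adj Q\<^esub> (inv\<^bsub>Adj Q\<^esub> u \<otimes>\<^bsub>Adj Q\<^esub> v) = v" "inv\<^bsub>Adj Q\<^esub> u \<otimes>\<^bsub>Adj Q\<^esub> (u \<otimes>\<^bsub>Adj Q\<^esub> v) = v"
    if "u \<in> carrier (Adj Q)" "v \<in> carrier (Adj Q)" for u v
    using that by (simp_all flip: A.m_assoc)
  interpret P: quandle ?P
  proof
    fix x y z assume x: "x \<in> carrier ?P" and y: "y \<in> carrier ?P"
    show "x \<star>\<^bsub>?P\<^esub> y \<in> carrier ?P" "x \<diamondop>\<^bsub>?P\<^esub> y \<in> carrier ?P"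
      using x y cm cd by auto
    show "x \<star>\<^bsub>?P\<^esub> x = x" using x act[OF x] by (simp add: qm)
    show "(x \<star>\<^bsub>?P\<^esub> y) \<diamondop>\<^bsub>?P\<^esub> y = x"
      unfolding qd[OF cm[OF x y] y] unfolding qm[OF x y] using act[OF x] act[OF y]
      by (simp add: adj_qmult A.m_assoc canc)
    show "(x \<diamondop>\<^bsub>?P\<^esub> y) \<star>\<^bsub>?P\<^esub> y = x"
      unfolding qm[OF cd[OF x y] y] unfolding qd[OF x y] using act[OF x] act[OF y]
      by (simp add: adj_qdiv A.m_assoc canc A.inv_mult_group)
    assume z: "z \<in> carrier ?P"
    show "(x \<star>\<^bsub>?P\<^esub> y) \<star>\<^bsub>?P\<^esub> z = (x \<star>\<^bsub>?P\<^esub> z) \<star>\<^bsub>?P\<^esub> (y \<star>\<^bsub>?P\<^esub> z)"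
      unfolding qm[OF cm[OF x y] z] qm[OF cm[OF x z] cm[OF y z]]
      unfolding qm[OF x y] qm[OF x z] qm[OF y z] using act[OF x] act[OF y] act[OF z]
      by (simp add: self_distrib[of "fst x" "fst y" "fst z"] adj_qmult A.m_assoc canc A.inv_mult_group)
  qed
  show ?thesis
  proof
    show "univ_cover_proj \<in> quandle_hom ?P Q"
      using act by (auto simp: quandle_hom_def univ_cover_proj_def case_prod_unfold qm)
    show "univ_cover_proj ` carrier ?P = carrier Q"
    proof
      show "univ_cover_proj ` carrier ?P \<subseteq> carrier Q"
        using act by (auto simp: univ_cover_proj_def case_prod_unfold)
      show "carrier Q \<subseteq> univ_cover_proj ` carrier ?P"
      proof
        fix a assume a: "a \<in> carrier Q"
        then obtain g where "g \<in> Adj_derived Q" "adj_act Q q g = a"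
          using adj_act_transitive q by blast
        then have "(a, g) \<in> carrier ?P" using a by (simp add: carr)
        then show "a \<in> univ_cover_proj ` carrier ?P"
          by (force simp: univ_cover_proj_def)
      qed
    qed
    fix x y z assume "x \<in> carrier ?P" "y \<in> carrier ?P" "z \<in> carrier ?P"
      "univ_cover_proj y = univ_cover_proj z"
    then show "x \<star>\<^bsub>?P\<^esub> y = x \<star>\<^bsub>?P\<^esub> z"
      by (simp add: qm univ_cover_proj_def case_prod_unfold)
  qed
qed

end

end

theory Submission
  imports Defs
begin

text \<open>Two facts carry the proof.

  Rigidity. A deck transformation \<open>f\<close> of a covering \<open>p: P \<rightarrow> Q\<close> satisfies
  \<open>f (x \<star> y) = f x \<star> f y = f x \<star> y\<close>, since \<open>f y\<close> and \<open>y\<close> lie in the same fibre. It thus commutes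
  with every translation of \<open>P\<close>, and its value at one point determines it on the orbit of that
  point under the translations (lemma \<open>covering_Aut_word_act\<close>).

  Connectedness of the universal covering. Write \<open>t = adj q\<close>. The operation of \<open>univ_cover Q q\<close> is
  made so that a word \<open>w\<close> with exponent sum \<open>n\<close>, applied by translations to the base point \<open>(q, 1)\<close>,
  leads to \<open>(q\<^sup>w, t\<^sup>-\<^sup>n w)\<close> (lemma \<open>univ_cover_lift_word\<close>). Every element of the commutator
  subgroup is represented by a word with exponent sum zero, so every point \<open>(q\<^sup>g, g)\<close> is reached.

  Left multiplication by \<open>h \<in> \<pi>\<^sub>1(Q, q)\<close> does not interfere with the operations, which multiply the
  group component on the right; it is a deck transformation, and \<open>deck_action\<close> is a homomorphism.
  As it takes \<open>(q, 1)\<close> to \<open>(q, h)\<close>, it is injective. Conversely a deck transformation \<open>f\<close> takes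
  \<open>(q, 1)\<close> to some \<open>(q, h)\<close>, where \<open>q\<^sup>h = q\<close> because \<open>(q, h)\<close> is a point of the covering; by the
  two facts above, \<open>f\<close> is the action of \<open>h\<close>.\<close>


section \<open>Deck transformations commute with translations\<close>

context quandle_covering
begin

lemma covering_AutD:
  assumes "f \<in> carrier (covering_Aut P p)"
  shows "f \<in> Bij (carrier P)" "f \<in> quandle_hom P P" "\<And>x. x \<in> carrier P \<Longrightarrow> p (f x) = p x"
    "\<And>x. x \<in> carrier P \<Longrightarrow> f x \<in> carrier P"
  using assms by (auto simp: covering_Aut_def quandle_Aut_def quandle_hom_def)

lemma covering_Aut_qmult:
  assumes f: "f \<in> carrier (covering_Aut P p)" and x: "x \<in> carrier P" and y: "y \<in> carrier P"
  shows "f (x \<star>\<^bsub>P\<^esub> y) = f x \<star>\<^bsub>P\<^esub> y"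
proof -
  have "f (x \<star>\<^bsub>P\<^esub> y) = f x \<star>\<^bsub>P\<^esub> f y"
    using covering_AutD(2)[OF f] x y by (auto simp: quandle_hom_def)
  also have "\<dots> = f x \<star>\<^bsub>P\<^esub> y"
    using covering_AutD[OF f] x y by (intro fibres) auto
  finally show ?thesis .
qed

lemma covering_Aut_qdiv:
  assumes f: "f \<in> carrier (covering_Aut P p)" and x: "x \<in> carrier P" and y: "y \<in> carrier P"
  shows "f (x \<diamondop>\<^bsub>P\<^esub> y) = f x \<diamondop>\<^bsub>P\<^esub> y"
proof -
  have "f (x \<diamondop>\<^bsub>P\<^esub> y) \<star>\<^bsub>P\<^esub> y = f x"
    using covering_Aut_qmult[OF f _ y, of "x \<diamondop>\<^bsub>P\<^esub> y"] x y by simp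
  then show ?thesis
    using P.qmult_qdiv[of "f (x \<diamondop>\<^bsub>P\<^esub> y)" y] covering_AutD(4)[OF f] x y by simp
qed

lemma covering_Aut_word_act:
  assumes f: "f \<in> carrier (covering_Aut P p)" and "w \<in> words (carrier P)" "x \<in> carrier P"
  shows "f (word_act P w x) = word_act P w (f x)"
  using assms(2,3)
proof (induction w arbitrary: x)
  case Nil
  then show ?case by (simp add: word_act_def)
next
  case (Cons l w)
  then show ?case
    using covering_Aut_qmult[OF f] covering_Aut_qdiv[OF f]
    by (cases l) (auto simp: word_act_def)
qed

text \<open>The hypothesis \<open>orbit\<close> says that \<open>P\<close> is connected, seen from the point \<open>b\<close>.\<close>

lemma covering_Aut_eqI:
  assumes f: "f \<in> carrier (covering_Aut P p)" and g: "g \<in> carrier (covering_Aut P p)"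
    and b: "b \<in> carrier P" "f b = g b"
    and orbit: "\<And>x. x \<in> carrier P \<Longrightarrow> \<exists>w\<in>words (carrier P). word_act P w b = x"
  shows "f = g"
proof (rule extensionalityI)
  show "f \<in> extensional (carrier P)" "g \<in> extensional (carrier P)"
    using covering_AutD(1)[OF f] covering_AutD(1)[OF g] by (auto simp: Bij_def)
  fix x assume "x \<in> carrier P"
  then obtain w where "w \<in> words (carrier P)" "word_act P w b = x" using orbit by blast
  then show "f x = g x"
    using covering_Aut_word_act[OF f] covering_Aut_word_act[OF g] b by metis
qed

end


section \<open>Words with exponent sum zero\<close>

fun letter_exponent :: "'a letter \<Rightarrow> int" where
  "letter_exponent (Gen a) = 1"
| "letter_exponent (Inv a) = - 1"

definition exponent_sum :: "'a word \<Rightarrow> int"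
  where "exponent_sum w = (\<Sum>l\<leftarrow>w. letter_exponent l)"

lemma exponent_sum_simps [simp]:
  "exponent_sum [] = 0"
  "exponent_sum [l] = letter_exponent l"
  "exponent_sum (u @ v) = exponent_sum u + exponent_sum v"
  by (simp_all add: exponent_sum_def)

definition word_inv :: "'a word \<Rightarrow> 'a word"
  where "word_inv w = rev (map letter_inv w)"

lemma exponent_sum_word_inv [simp]: "exponent_sum (word_inv w) = - exponent_sum w"
proof -
  have "letter_exponent (letter_inv l) = - letter_exponent l" for l :: "'a letter"
    by (cases l) auto
  then show ?thesis
    by (induction w) (auto simp: exponent_sum_def word_inv_def)
qed

lemma word_inv_words [simp]: "w \<in> words S \<Longrightarrow> word_inv w \<in> words S"
proof (induction w)
  case (Cons l w)
  then show ?case by (cases l) (auto simp: word_inv_def)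
qed (simp add: word_inv_def)

lemma pres_eq_word_inv: "w \<in> words S \<Longrightarrow> pres_eq S R (word_inv w @ w) []"
proof (induction w)
  case Nil
  then show ?case by (simp add: word_inv_def pres_eq.refl)
next
  case (Cons l w)
  then have w: "w \<in> words S" by (cases l) auto
  have l: "pres_eq S R [letter_inv l, l] []"
    using Cons.prems by (cases l) (auto intro: pres_eq.Gen_Inv pres_eq.Inv_Gen)
  have "pres_eq S R (word_inv w @ ([letter_inv l, l] @ w)) (word_inv w @ ([] @ w))"
    using w by (intro pres_eq.cong pres_eq.refl l) auto
  then show ?case
    using pres_eq.trans[OF _ Cons.IH[OF w]] by (simp add: word_inv_def)
qed

lemma inv_word_class:
  assumes "w \<in> words S"
  shows "inv\<^bsub>presented_group S R\<^esub> word_class S R w = word_class S R (word_inv w)"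
proof -
  interpret G: group "presented_group S R" by (rule group_presented_group)
  have "word_class S R (word_inv w) \<otimes>\<^bsub>presented_group S R\<^esub> word_class S R w = word_class S R []"
    using assms pres_eq_word_inv by (simp add: word_class_mult word_class_eq_iff)
  then show ?thesis
    using assms by (intro G.inv_equality) (auto simp: presented_group_def)
qed

text \<open>A commutator of the classes of \<open>u\<close> and \<open>v\<close> is represented by \<open>u v u\<^sup>-\<^sup>1 v\<^sup>-\<^sup>1\<close>, in which the
  exponents cancel; concatenation and formal inversion keep the exponent sum zero.\<close>

lemma derived_presented_group_word:
  assumes "g \<in> derived (presented_group S R) (carrier (presented_group S R))"
  shows "\<exists>w\<in>words S. exponent_sum w = 0 \<and> g = word_class S R w"
proof -
  let ?G = "presented_group S R"
  have comm: "\<exists>w\<in>words S. exponent_sum w = 0 \<and>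
      x \<otimes>\<^bsub>?G\<^esub> y \<otimes>\<^bsub>?G\<^esub> inv\<^bsub>?G\<^esub> x \<otimes>\<^bsub>?G\<^esub> inv\<^bsub>?G\<^esub> y = word_class S R w"
    if xy: "x \<in> carrier ?G" "y \<in> carrier ?G" for x y
  proof -
    obtain u v where "u \<in> words S" "x = word_class S R u" "v \<in> words S" "y = word_class S R v"
      using xy by (auto simp: presented_group_def)
    then show ?thesis
      by (intro bexI[of _ "u @ v @ word_inv u @ word_inv v"])
         (auto simp: inv_word_class word_class_mult)
  qed
  show ?thesis
    using assms unfolding derived_def
  proof (induction rule: generate.induct)
    case one
    then show ?case by (intro bexI[of _ "[]"]) (auto simp: presented_group_def)
  next
    case (incl h)
    then show ?case using comm by blast
  next
    case (inv h)
    then obtain w where "w \<in> words S" "exponent_sum w = 0" "h = word_class S R w"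
      using comm by blast
    then show ?case by (intro bexI[of _ "word_inv w"]) (auto simp: inv_word_class)
  next
    case (eng g h)
    then obtain u v where "u \<in> words S" "exponent_sum u = 0" "g = word_class S R u"
      "v \<in> words S" "exponent_sum v = 0" "h = word_class S R v" by blast
    then show ?case by (intro bexI[of _ "u @ v"]) (auto simp: word_class_mult)
  qed
qed


section \<open>Connectedness of the universal covering\<close>

context quandle
begin

text \<open>For a generator \<open>g\<close> or its inverse this is a defining relation of the adjoint group; both sides
  are compatible with products in \<open>g\<close>.\<close>

lemma adj_adj_act:
  assumes "x \<in> carrier Q" "g \<in> carrier (Adj Q)"
  shows "adj Q (adj_act Q x g) = inv\<^bsub>Adj Q\<^esub> g \<otimes>\<^bsub>Adj Q\<^esub> adj Q x \<otimes>\<^bsub>Adj Q\<^esub> g"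
proof -
  interpret A: group "Adj Q" by (rule group_Adj)
  let ?c = "word_class (carrier Q) (adj_relations Q)"
  have "adj Q (adj_act Q x (?c w)) = inv\<^bsub>Adj Q\<^esub> ?c w \<otimes>\<^bsub>Adj Q\<^esub> adj Q x \<otimes>\<^bsub>Adj Q\<^esub> ?c w"
    if "w \<in> words (carrier Q)" for w
    using that
  proof (induction w rule: rev_induct)
    case Nil
    have "?c [] = \<one>\<^bsub>Adj Q\<^esub>" by (simp add: Adj_def presented_group_def)
    then show ?case using assms by (simp add: adj_act_one)
  next
    case (snoc l w)
    then have w: "w \<in> words (carrier Q)" and lc: "[l] \<in> words (carrier Q)"
      by simp_all
    have wl: "?c (w @ [l]) = ?c w \<otimes>\<^bsub>Adj Q\<^esub> ?c [l]"
      using w lc by (simp add: Adj_def word_class_mult)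
    have C: "?c w \<in> carrier (Adj Q)" "?c [l] \<in> carrier (Adj Q)"
      using w lc by (auto simp: carrier_Adj)
    let ?a = "adj_act Q x (?c w)"
    have a: "?a \<in> carrier Q" using C assms by (simp add: adj_act_closed)
    have "adj Q (adj_act Q ?a (?c [l])) = inv\<^bsub>Adj Q\<^esub> ?c [l] \<otimes>\<^bsub>Adj Q\<^esub> adj Q ?a \<otimes>\<^bsub>Adj Q\<^esub> ?c [l]"
    proof (cases l)
      case (Gen b)
      then have b: "b \<in> carrier Q" and "?c [l] = adj Q b" using lc by (auto simp: adj_def)
      then show ?thesis using a by (simp add: adj_act_adj adj_qmult)
    next
      case (Inv b)
      then have b: "b \<in> carrier Q" using lc by auto
      then have "?c [l] = inv\<^bsub>Adj Q\<^esub> adj Q b" using Inv by (simp add: inv_adj)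
      then show ?thesis using a b by (simp add: adj_act_adj adj_qdiv)
    qed
    then show ?case
      using snoc.IH[OF w] C assms
      by (simp add: wl adj_act_mult A.inv_mult_group A.m_assoc)
  qed
  then show ?thesis using assms by (auto simp: carrier_Adj)
qed

end

context connected_quandle
begin

lemma univ_cover_base: "q \<in> carrier Q \<Longrightarrow> (q, \<one>\<^bsub>Adj Q\<^esub>) \<in> carrier (univ_cover Q q)"
  using subgroup.one_closed[OF subgroup_Adj_derived] by (simp add: univ_cover_def adj_act_one)

text \<open>Let \<open>t = adj q\<close>. At the point \<open>(a, t\<^sup>-\<^sup>n w)\<close> with \<open>a = q\<^sup>w\<close> one has \<open>adj a = w\<^sup>-\<^sup>1 t w\<close>, so that
  translation by a point over \<open>b\<close> changes the group component to
  \<open>t\<^sup>-\<^sup>n w (w\<^sup>-\<^sup>1 t w)\<^sup>-\<^sup>1 adj b = t\<^sup>-\<^sup>n\<^sup>-\<^sup>1 (w adj b)\<close>; inverse translations are similar.\<close>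

lemma univ_cover_lift_word:
  assumes q: "q \<in> carrier Q" and "w \<in> words (carrier Q)"
  shows "\<exists>v\<in>words (carrier (univ_cover Q q)).
    word_act (univ_cover Q q) v (q, \<one>\<^bsub>Adj Q\<^esub>) =
      (word_act Q w q, adj Q q [^]\<^bsub>Adj Q\<^esub> (- exponent_sum w) \<otimes>\<^bsub>Adj Q\<^esub>
         word_class (carrier Q) (adj_relations Q) w)"
  using assms(2)
proof (induction w rule: rev_induct)
  case Nil
  have "word_class (carrier Q) (adj_relations Q) [] = \<one>\<^bsub>Adj Q\<^esub>"
    by (simp add: Adj_def presented_group_def)
  moreover have "\<one>\<^bsub>Adj Q\<^esub> \<otimes>\<^bsub>Adj Q\<^esub> \<one>\<^bsub>Adj Q\<^esub> = \<one>\<^bsub>Adj Q\<^esub>"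
    by (intro monoid.r_one monoid.one_closed group.is_monoid group_Adj)
  ultimately show ?case
    by (intro bexI[of _ "[]"]) (simp_all add: word_act_def)
next
  case (snoc l w)
  interpret A: group "Adj Q" by (rule group_Adj)
  interpret C: quandle_covering "univ_cover Q q" Q univ_cover_proj
    by (rule univ_cover_quandle_covering[OF q])
  let ?P = "univ_cover Q q"
  let ?c = "word_class (carrier Q) (adj_relations Q)"
  let ?t = "adj Q q" and ?n = "exponent_sum w" and ?u = "?c w"
  have w: "w \<in> words (carrier Q)" and lc: "[l] \<in> words (carrier Q)"
    using snoc.prems by simp_all
  have u: "?u \<in> carrier (Adj Q)" using w by (auto simp: carrier_Adj)
  have t: "?t \<in> carrier (Adj Q)" using q by simp
  define a where "a = word_act Q w q"
  have a: "a \<in> carrier Q" using w q by (simp add: a_def word_act_closed)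
  have adj_a: "adj Q a = inv\<^bsub>Adj Q\<^esub> ?u \<otimes>\<^bsub>Adj Q\<^esub> ?t \<otimes>\<^bsub>Adj Q\<^esub> ?u"
    using adj_adj_act[OF q u] w q by (simp add: a_def adj_act_word_class)
  obtain v where v: "v \<in> words (carrier ?P)"
    "word_act ?P v (q, \<one>\<^bsub>Adj Q\<^esub>) = (a, ?t [^]\<^bsub>Adj Q\<^esub> (- ?n) \<otimes>\<^bsub>Adj Q\<^esub> ?u)"
    using snoc.IH[OF w] a_def by blast
  have wl: "?c (w @ [l]) = ?u \<otimes>\<^bsub>Adj Q\<^esub> ?c [l]"
    using w lc by (simp add: Adj_def word_class_mult)
  have canc: "x \<otimes>\<^bsub>Adj Q\<^esub> (inv\<^bsub>Adj Q\<^esub> x \<otimes>\<^bsub>Adj Q\<^esub> y) = y"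
    if "x \<in> carrier (Adj Q)" "y \<in> carrier (Adj Q)" for x y
    using that by (simp flip: A.m_assoc)
  \<comment> \<open>any lift of the letter will do, since points of one fibre translate alike\<close>
  have lift: "\<exists>y. (b, y) \<in> carrier ?P" if "b \<in> carrier Q" for b
    using C.surj that by (force simp: univ_cover_proj_def)
  show ?case
  proof (cases l)
    case (Gen b)
    then have b: "b \<in> carrier Q" using lc by simp
    then obtain y where y: "(b, y) \<in> carrier ?P" using lift by blast
    have pow: "?t [^]\<^bsub>Adj Q\<^esub> (- (?n + 1)) = ?t [^]\<^bsub>Adj Q\<^esub> (- ?n) \<otimes>\<^bsub>Adj Q\<^esub> inv\<^bsub>Adj Q\<^esub> ?t"
      using A.int_pow_mult[OF t, of "- ?n" "- 1"] t by (simp add: A.int_pow_neg)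
    have cl: "?c [l] = adj Q b" using Gen by (simp add: adj_def)
    have target: "word_act Q (w @ [l]) q = a \<star> b" "exponent_sum (w @ [l]) = ?n + 1"
      using Gen by (simp_all add: word_act_append a_def, simp add: word_act_def)
    have "word_act ?P (v @ [Gen (b, y)]) (q, \<one>\<^bsub>Adj Q\<^esub>) =
        (a \<star> b, ?t [^]\<^bsub>Adj Q\<^esub> (- ?n) \<otimes>\<^bsub>Adj Q\<^esub> ?u \<otimes>\<^bsub>Adj Q\<^esub> inv\<^bsub>Adj Q\<^esub> adj Q a \<otimes>\<^bsub>Adj Q\<^esub> adj Q b)"
      using v(2) by (simp add: C.P.word_act_append, simp add: word_act_def univ_cover_def)
    also have "\<dots> = (word_act Q (w @ [l]) q,
        ?t [^]\<^bsub>Adj Q\<^esub> (- exponent_sum (w @ [l])) \<otimes>\<^bsub>Adj Q\<^esub> ?c (w @ [l]))"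
      unfolding wl cl target pow using a b t u by (simp add: adj_a A.m_assoc canc A.inv_mult_group)
    finally show ?thesis
      using v(1) y by (intro bexI[of _ "v @ [Gen (b, y)]"]) simp_all
  next
    case (Inv b)
    then have b: "b \<in> carrier Q" using lc by simp
    then obtain y where y: "(b, y) \<in> carrier ?P" using lift by blast
    have pow: "?t [^]\<^bsub>Adj Q\<^esub> (- (?n - 1)) = ?t [^]\<^bsub>Adj Q\<^esub> (- ?n) \<otimes>\<^bsub>Adj Q\<^esub> ?t"
      using A.int_pow_mult[OF t, of "- ?n" "1"] t by simp
    have cl: "?c [l] = inv\<^bsub>Adj Q\<^esub> adj Q b" using Inv b by (simp add: inv_adj)
    have target: "word_act Q (w @ [l]) q = a \<diamondop> b" "exponent_sum (w @ [l]) = ?n - 1"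
      using Inv by (simp_all add: word_act_append a_def, simp add: word_act_def)
    have "word_act ?P (v @ [Inv (b, y)]) (q, \<one>\<^bsub>Adj Q\<^esub>) =
        (a \<diamondop> b, ?t [^]\<^bsub>Adj Q\<^esub> (- ?n) \<otimes>\<^bsub>Adj Q\<^esub> ?u \<otimes>\<^bsub>Adj Q\<^esub> adj Q a \<otimes>\<^bsub>Adj Q\<^esub> inv\<^bsub>Adj Q\<^esub> adj Q b)"
      using v(2) by (simp add: C.P.word_act_append, simp add: word_act_def univ_cover_def)
    also have "\<dots> = (word_act Q (w @ [l]) q,
        ?t [^]\<^bsub>Adj Q\<^esub> (- exponent_sum (w @ [l])) \<otimes>\<^bsub>Adj Q\<^esub> ?c (w @ [l]))"
      unfolding wl cl target pow using a b t u by (simp add: adj_a A.m_assoc canc A.inv_mult_group)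
    finally show ?thesis
      using v(1) y by (intro bexI[of _ "v @ [Inv (b, y)]"]) simp_all
  qed
qed

lemma univ_cover_connected:
  assumes q: "q \<in> carrier Q" and x: "x \<in> carrier (univ_cover Q q)"
  shows "\<exists>v\<in>words (carrier (univ_cover Q q)). word_act (univ_cover Q q) v (q, \<one>\<^bsub>Adj Q\<^esub>) = x"
proof -
  interpret A: group "Adj Q" by (rule group_Adj)
  obtain g where g: "g \<in> Adj_derived Q" "x = (adj_act Q q g, g)"
    using x by (auto simp: univ_cover_def)
  obtain w where w: "w \<in> words (carrier Q)" "exponent_sum w = 0"
    "g = word_class (carrier Q) (adj_relations Q) w"
    using derived_presented_group_word g(1) unfolding Adj_derived_def Adj_def by blast
  show ?thesis
    using univ_cover_lift_word[OF q w(1)] w g q Adj_derived_carrier[OF g(1)]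
    by (simp add: adj_act_word_class)
qed

end


section \<open>The action of the fundamental group\<close>

context connected_quandle
begin

lemma subgroup_fundamental_group:
  assumes q: "q \<in> carrier Q"
  shows "subgroup {g \<in> Adj_derived Q. adj_act Q q g = q} (Adj Q)"
proof -
  interpret A: group "Adj Q" by (rule group_Adj)
  interpret D: subgroup "Adj_derived Q" "Adj Q" by (rule subgroup_Adj_derived)
  show ?thesis
  proof (rule A.subgroupI)
    show "{g \<in> Adj_derived Q. adj_act Q q g = q} \<noteq> {}"
      using q D.one_closed adj_act_one by blast
    fix g assume g: "g \<in> {g \<in> Adj_derived Q. adj_act Q q g = q}"
    then have "adj_act Q q (inv\<^bsub>Adj Q\<^esub> g) = adj_act Q q (g \<otimes>\<^bsub>Adj Q\<^esub> inv\<^bsub>Adj Q\<^esub> g)"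
      using q adj_act_mult[of q g "inv\<^bsub>Adj Q\<^esub> g"] by (simp add: Adj_derived_carrier del: A.r_inv)
    then show "inv\<^bsub>Adj Q\<^esub> g \<in> {g \<in> Adj_derived Q. adj_act Q q g = q}"
      using g q by (simp add: Adj_derived_carrier adj_act_one)
  qed (use q in \<open>auto simp: adj_act_mult Adj_derived_carrier\<close>)
qed

lemma group_fundamental_group: "q \<in> carrier Q \<Longrightarrow> group (fundamental_group Q q)"
  unfolding fundamental_group_def
  by (rule subgroup.subgroup_is_group[OF subgroup_fundamental_group group_Adj])

lemma fundamental_groupD:
  assumes "h \<in> carrier (fundamental_group Q q)"
  shows "h \<in> Adj_derived Q" "h \<in> carrier (Adj Q)" "adj_act Q q h = q"
  using assms by (auto simp: fundamental_group_def Adj_derived_carrier)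

lemma deck_action_closed:
  assumes "q \<in> carrier Q" "h \<in> carrier (fundamental_group Q q)" "x \<in> carrier (univ_cover Q q)"
  shows "deck_action Q q h x \<in> carrier (univ_cover Q q)"
proof -
  obtain g where "g \<in> Adj_derived Q" "x = (adj_act Q q g, g)"
    using assms(3) by (auto simp: univ_cover_def)
  then show ?thesis
    using assms fundamental_groupD[OF assms(2)] subgroup.m_closed[OF subgroup_Adj_derived]
    by (auto simp: deck_action_def univ_cover_def adj_act_mult Adj_derived_carrier)
qed

lemma deck_action_one:
  assumes "x \<in> carrier (univ_cover Q q)"
  shows "deck_action Q q \<one>\<^bsub>Adj Q\<^esub> x = x"
proof -
  interpret A: group "Adj Q" by (rule group_Adj)
  show ?thesis
    using assms by (auto simp: deck_action_def univ_cover_def Adj_derived_carrier)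
qed

lemma deck_action_mult:
  assumes "q \<in> carrier Q" "h \<in> carrier (fundamental_group Q q)"
    "k \<in> carrier (fundamental_group Q q)" "x \<in> carrier (univ_cover Q q)"
  shows "deck_action Q q (h \<otimes>\<^bsub>Adj Q\<^esub> k) x = deck_action Q q h (deck_action Q q k x)"
proof -
  interpret A: group "Adj Q" by (rule group_Adj)
  obtain a g where x: "x = (a, g)" "g \<in> carrier (Adj Q)"
    using assms(4) by (auto simp: univ_cover_def Adj_derived_carrier)
  have "(a, k \<otimes>\<^bsub>Adj Q\<^esub> g) \<in> carrier (univ_cover Q q)"
    using deck_action_closed[OF assms(1,3,4)] assms(4) x by (simp add: deck_action_def)
  then show ?thesis
    using assms(4) x fundamental_groupD[OF assms(2)] fundamental_groupD[OF assms(3)]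
    by (simp add: deck_action_def A.m_assoc)
qed

lemma deck_action_Bij:
  assumes q: "q \<in> carrier Q" and h: "h \<in> carrier (fundamental_group Q q)"
  shows "deck_action Q q h \<in> Bij (carrier (univ_cover Q q))"
proof -
  interpret A: group "Adj Q" by (rule group_Adj)
  interpret H: subgroup "carrier (fundamental_group Q q)" "Adj Q"
    using subgroup_fundamental_group[OF q] by (simp add: fundamental_group_def)
  let ?k = "inv\<^bsub>Adj Q\<^esub> h"
  have k: "?k \<in> carrier (fundamental_group Q q)" using h by (rule H.m_inv_closed)
  have hk: "h \<otimes>\<^bsub>Adj Q\<^esub> ?k = \<one>\<^bsub>Adj Q\<^esub>" "?k \<otimes>\<^bsub>Adj Q\<^esub> h = \<one>\<^bsub>Adj Q\<^esub>"
    using fundamental_groupD(2)[OF h] by simp_all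
  have "bij_betw (deck_action Q q h) (carrier (univ_cover Q q)) (carrier (univ_cover Q q))"
    using deck_action_mult[OF q h k] deck_action_mult[OF q k h] hk
      deck_action_closed[OF q h] deck_action_closed[OF q k]
    by (intro bij_betw_byWitness[where f' = "deck_action Q q ?k"]) (auto simp: deck_action_one)
  then show ?thesis by (auto simp: Bij_def deck_action_def)
qed

lemma deck_action_covering_Aut:
  assumes q: "q \<in> carrier Q" and h: "h \<in> carrier (fundamental_group Q q)"
  shows "deck_action Q q h \<in> carrier (covering_Aut (univ_cover Q q) univ_cover_proj)"
proof -
  interpret A: group "Adj Q" by (rule group_Adj)
  interpret C: quandle_covering "univ_cover Q q" Q univ_cover_proj
    by (rule univ_cover_quandle_covering[OF q])
  let ?P = "univ_cover Q q"
  have "deck_action Q q h (x \<star>\<^bsub>?P\<^esub> y) = deck_action Q q h x \<star>\<^bsub>?P\<^esub> deck_action Q q h y"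
    if "x \<in> carrier ?P" "y \<in> carrier ?P" for x y
  proof -
    have xy: "fst x \<in> carrier Q" "fst y \<in> carrier Q" "snd x \<in> carrier (Adj Q)"
      using that by (auto simp: univ_cover_def Adj_derived_carrier)
    have "x \<star>\<^bsub>?P\<^esub> y = (fst x \<star> fst y,
        snd x \<otimes>\<^bsub>Adj Q\<^esub> inv\<^bsub>Adj Q\<^esub> (adj Q (fst x)) \<otimes>\<^bsub>Adj Q\<^esub> adj Q (fst y))"
      by (simp add: univ_cover_def case_prod_unfold)
    moreover have "deck_action Q q h x = (fst x, h \<otimes>\<^bsub>Adj Q\<^esub> snd x)"
      "deck_action Q q h y = (fst y, h \<otimes>\<^bsub>Adj Q\<^esub> snd y)"
      using that by (simp_all add: deck_action_def case_prod_unfold)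
    then have "deck_action Q q h x \<star>\<^bsub>?P\<^esub> deck_action Q q h y = (fst x \<star> fst y,
        h \<otimes>\<^bsub>Adj Q\<^esub> snd x \<otimes>\<^bsub>Adj Q\<^esub> inv\<^bsub>Adj Q\<^esub> (adj Q (fst x)) \<otimes>\<^bsub>Adj Q\<^esub> adj Q (fst y))"
      by (simp add: univ_cover_def)
    moreover have "x \<star>\<^bsub>?P\<^esub> y \<in> carrier ?P"
      using that by (rule C.P.qmult_closed)
    ultimately show ?thesis
      using xy fundamental_groupD(2)[OF h]
      by (simp add: deck_action_def case_prod_unfold A.m_assoc)
  qed
  then show ?thesis
    using deck_action_Bij[OF q h] deck_action_closed[OF q h]
    by (auto simp: covering_Aut_def quandle_Aut_def quandle_hom_def BijGroup_def deck_action_def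
        univ_cover_proj_def)
qed

lemma compose_deck_action:
  assumes "q \<in> carrier Q" "h \<in> carrier (fundamental_group Q q)" "k \<in> carrier (fundamental_group Q q)"
  shows "compose (carrier (univ_cover Q q)) (deck_action Q q h) (deck_action Q q k) =
    deck_action Q q (h \<otimes>\<^bsub>fundamental_group Q q\<^esub> k)"
proof (rule extensionalityI)
  show "compose (carrier (univ_cover Q q)) (deck_action Q q h) (deck_action Q q k)
      \<in> extensional (carrier (univ_cover Q q))"
    by simp
  show "deck_action Q q (h \<otimes>\<^bsub>fundamental_group Q q\<^esub> k) \<in> extensional (carrier (univ_cover Q q))"
    by (simp add: deck_action_def)
qed (use deck_action_mult[OF assms] in \<open>simp add: compose_eq fundamental_group_def\<close>)

lemma group_action_deck_action:
  assumes q: "q \<in> carrier Q"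
  shows "group_action (fundamental_group Q q) (carrier (univ_cover Q q)) (deck_action Q q)"
  unfolding group_action_def group_hom_def group_hom_axioms_def
proof (intro conjI group_fundamental_group[OF q] group_BijGroup homI)
  fix h k assume "h \<in> carrier (fundamental_group Q q)" "k \<in> carrier (fundamental_group Q q)"
  then show "deck_action Q q (h \<otimes>\<^bsub>fundamental_group Q q\<^esub> k) =
      deck_action Q q h \<otimes>\<^bsub>BijGroup (carrier (univ_cover Q q))\<^esub> deck_action Q q k"
    using q by (simp add: BijGroup_def deck_action_Bij compose_deck_action)
qed (use q in \<open>simp add: BijGroup_def deck_action_Bij\<close>)

lemma deck_action_base:
  assumes "q \<in> carrier Q" "h \<in> carrier (fundamental_group Q q)"
  shows "deck_action Q q h (q, \<one>\<^bsub>Adj Q\<^esub>) = (q, h)"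
proof -
  interpret A: group "Adj Q" by (rule group_Adj)
  show ?thesis
    using univ_cover_base[OF assms(1)] fundamental_groupD(2)[OF assms(2)]
    by (simp add: deck_action_def)
qed

lemma covering_Aut_is_deck_action:
  assumes q: "q \<in> carrier Q"
    and f: "f \<in> carrier (covering_Aut (univ_cover Q q) univ_cover_proj)"
  shows "\<exists>h\<in>carrier (fundamental_group Q q). f = deck_action Q q h"
proof -
  interpret C: quandle_covering "univ_cover Q q" Q univ_cover_proj
    by (rule univ_cover_quandle_covering[OF q])
  let ?b = "(q, \<one>\<^bsub>Adj Q\<^esub>)"
  note b = univ_cover_base[OF q]
  obtain h where h: "f ?b = (q, h)"
    using C.covering_AutD(3)[OF f b] by (cases "f ?b") (auto simp: univ_cover_proj_def)
  then have "(q, h) \<in> carrier (univ_cover Q q)"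
    using C.covering_AutD(4)[OF f b] by simp
  then have h': "h \<in> carrier (fundamental_group Q q)"
    by (auto simp: univ_cover_def fundamental_group_def)
  then have "f = deck_action Q q h"
    using C.covering_Aut_eqI[OF f deck_action_covering_Aut[OF q h'] b] h
      deck_action_base[OF q h'] univ_cover_connected[OF q] by simp
  then show ?thesis using h' by blast
qed

lemma deck_action_iso:
  assumes q: "q \<in> carrier Q"
  shows "deck_action Q q \<in>
    iso (fundamental_group Q q) (covering_Aut (univ_cover Q q) univ_cover_proj)"
proof (rule isoI)
  show "deck_action Q q \<in>
      hom (fundamental_group Q q) (covering_Aut (univ_cover Q q) univ_cover_proj)"
  proof (rule homI)
    fix h k assume "h \<in> carrier (fundamental_group Q q)" "k \<in> carrier (fundamental_group Q q)"
    then show "deck_action Q q (h \<otimes>\<^bsub>fundamental_group Q q\<^esub> k) =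
        deck_action Q q h \<otimes>\<^bsub>covering_Aut (univ_cover Q q) univ_cover_proj\<^esub> deck_action Q q k"
      using q by (simp add: covering_Aut_def quandle_Aut_def BijGroup_def deck_action_Bij
          compose_deck_action)
  qed (rule deck_action_covering_Aut[OF q])
  have "inj_on (deck_action Q q) (carrier (fundamental_group Q q))"
    using deck_action_base[OF q] by (intro inj_onI) (metis prod.inject)
  then show "bij_betw (deck_action Q q) (carrier (fundamental_group Q q))
      (carrier (covering_Aut (univ_cover Q q) univ_cover_proj))"
    using deck_action_covering_Aut[OF q] covering_Aut_is_deck_action[OF q]
    by (auto simp: bij_betw_def)
qed

end

theorem proposition5p6:
  fixes Q :: "('a, 'b) quandle_str_scheme" and q :: 'a
  assumes "connected_quandle Q" and "q \<in> carrier Q"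
  shows "group_action (fundamental_group Q q) (carrier (univ_cover Q q)) (deck_action Q q)
       \<and> deck_action Q q \<in>
           iso (fundamental_group Q q) (covering_Aut (univ_cover Q q) univ_cover_proj)"
proof -
  interpret connected_quandle Q by (rule assms(1))
  show ?thesis
    using group_action_deck_action[OF assms(2)] deck_action_iso[OF assms(2)] by blast
qed

end
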